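(* Let $A\in\mathcal{PC}_n$. Suppose that $A(n)$ is consistent. Then the Perron vector of $A$ is efficient for $A$.
   Context: $n\ge 2$. $\mathcal{PC}_n$ denotes the set of $n\times n$ reciprocal matrices, i.e. real matrices $A=[a_{ij}]$ with all entries positive and $a_{ji}=1/a_{ij}$ for all $i,j$ (so $a_{ii}=1$). A reciprocal matrix $A$ is consistent if $a_{ij}a_{jk}=a_{ik}$ for all $i,j,k$. The Perron vector of a positive square matrix is any entrywise positive (right) eigenvector (unique up to positive scalar multiple). $A(n)$ is the principal submatrix of $A$ obtained by deleting row and column $n$. A positive vector $w$ is efficient for $A\in\mathcal{PC}_n$ if, for every positive $n$-vector $v$, the inequalities $|a_{ij}-v_i/v_j|\le|a_{ij}-w_i/w_j|$ for all $i,j$ imply that $v$ is a positive scalar multiple of $w$. *)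

theory Defs
  imports "Jordan_Normal_Form.Char_Poly"
begin

(* Rows and columns are indexed by {0..<n}, so the last index is n - 1. *)

definition reciprocal_mats :: "nat \<Rightarrow> real mat set" where
  "reciprocal_mats n = {A \<in> carrier_mat n n.
     (\<forall>i<n. \<forall>j<n. A $$ (i, j) > 0 \<and> A $$ (j, i) = 1 / A $$ (i, j))}"

definition consistent_mat :: "nat \<Rightarrow> real mat \<Rightarrow> bool" where
  "consistent_mat n A \<longleftrightarrow> A \<in> reciprocal_mats n \<and>
     (\<forall>i<n. \<forall>j<n. \<forall>k<n. A $$ (i, j) * A $$ (j, k) = A $$ (i, k))"

definition pos_vecs :: "nat \<Rightarrow> real vec set" where
  "pos_vecs n = {v \<in> carrier_vec n. \<forall>i<n. v $ i > 0}"

(* Determined only up to a positive scalar factor, hence a predicate. *)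
definition perron_vector :: "nat \<Rightarrow> real mat \<Rightarrow> real vec \<Rightarrow> bool" where
  "perron_vector n A w \<longleftrightarrow> w \<in> pos_vecs n \<and> (\<exists>r. eigenvector A w r)"

definition efficient :: "nat \<Rightarrow> real mat \<Rightarrow> real vec \<Rightarrow> bool" where
  "efficient n A w \<longleftrightarrow> w \<in> pos_vecs n \<and>
     (\<forall>v \<in> pos_vecs n.
        (\<forall>i<n. \<forall>j<n. \<bar>A $$ (i, j) - v $ i / v $ j\<bar> \<le> \<bar>A $$ (i, j) - w $ i / w $ j\<bar>)
        \<longrightarrow> (\<exists>c>0. v = c \<cdot>\<^sub>v w))"

end

theory Submission
  imports Defs
begin

text \<open>
  Draw an edge from \<open>i\<close> to \<open>j\<close> when \<open>w\<^sub>i / w\<^sub>j\<close> overestimates \<open>a\<^sub>i\<^sub>j\<close>. A vector \<open>v\<close> that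
  approximates \<open>A\<close> at least as well as \<open>w\<close> cannot increase such a ratio, so the quotients
  \<open>v\<^sub>i / w\<^sub>i\<close> grow weakly along edges; if the digraph is strongly connected they are all equal
  and \<open>w\<close> is efficient (\<open>efficient_if_strongly_connected\<close>).

  For the Perron vector, write the consistent block as \<open>a\<^sub>i\<^sub>j = u\<^sub>i / u\<^sub>j\<close>, let \<open>m\<close> be the last index,
  and rescale: \<open>x\<^sub>i = w\<^sub>i / (u\<^sub>i w\<^sub>m)\<close> and \<open>\<beta>\<^sub>i = a\<^sub>i\<^sub>m / u\<^sub>i\<close>. The rows \<open>i < m\<close> of the eigenvector
  equation then read \<open>r x\<^sub>i = S + \<beta>\<^sub>i\<close> with \<open>S = \<Sum> x\<^sub>j\<close>, so \<open>x\<close> is ordered like \<open>\<beta>\<close>. Inside the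
  block the edges therefore run from larger to smaller \<open>\<beta>\<close>: an index \<open>p\<close> with \<open>\<beta>\<^sub>p\<close> maximal reaches
  all others, and an index \<open>q\<close> with \<open>\<beta>\<^sub>q\<close> minimal is reached from all others. It remains
  to return from \<open>q\<close> to \<open>p\<close> through \<open>m\<close>, that is, to show \<open>x\<^sub>q \<ge> \<beta>\<^sub>q\<close> and \<open>x\<^sub>p \<le> \<beta>\<^sub>p\<close>. Both follow
  from the fact that the Perron root of a reciprocal matrix is at least its size
  (\<open>reciprocal_eigenvalue_ge\<close>): otherwise \<open>x < \<beta>\<close> throughout, or \<open>x > \<beta>\<close> throughout, and either one
  makes \<open>r\<close> too small (\<open>bordered_crossing\<close>).
\<close>

definition outranking :: "nat \<Rightarrow> real mat \<Rightarrow> real vec \<Rightarrow> (nat \<times> nat) set" where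
  "outranking n A w = {(i, j). i < n \<and> j < n \<and> A $$ (i, j) \<le> w $ i / w $ j}"

lemma quotient_mono_outranking:
  assumes edge: "(i, j) \<in> outranking n A w"
    and w: "w \<in> pos_vecs n" and v: "v \<in> pos_vecs n"
    and le: "\<bar>A $$ (i, j) - v $ i / v $ j\<bar> \<le> \<bar>A $$ (i, j) - w $ i / w $ j\<bar>"
  shows "v $ i / w $ i \<le> v $ j / w $ j"
proof -
  have pos: "v $ i > 0" "v $ j > 0" "w $ i > 0" "w $ j > 0"
    using edge v w by (auto simp: outranking_def pos_vecs_def)
  have "A $$ (i, j) \<le> w $ i / w $ j"
    using edge by (simp add: outranking_def)
  then have "v $ i / v $ j \<le> w $ i / w $ j"
    using le by linarith
  then show ?thesis
    using pos by (simp add: field_simps)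
qed

text \<open>
  The quotients \<open>v\<^sub>i / w\<^sub>i\<close> are weakly increasing along paths, hence constant as soon as any two
  indices lie on a common closed walk.
\<close>
lemma efficient_if_strongly_connected:
  assumes w: "w \<in> pos_vecs n"
    and conn: "\<And>i j. i < n \<Longrightarrow> j < n \<Longrightarrow> (i, j) \<in> (outranking n A w)\<^sup>*"
  shows "efficient n A w"
  unfolding efficient_def
proof (intro conjI ballI impI w)
  fix v assume v: "v \<in> pos_vecs n"
    and le: "\<forall>i<n. \<forall>j<n. \<bar>A $$ (i, j) - v $ i / v $ j\<bar> \<le> \<bar>A $$ (i, j) - w $ i / w $ j\<bar>"
  have mono: "v $ i / w $ i \<le> v $ j / w $ j" if "(i, j) \<in> (outranking n A w)\<^sup>*" for i j
    using that
  proof (induction rule: rtrancl_induct)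
    case (step j k)
    then have "j < n" "k < n"
      by (auto simp: outranking_def)
    then have "v $ j / w $ j \<le> v $ k / w $ k"
      using quotient_mono_outranking[OF step.hyps(2) w v] le by blast
    then show ?case
      using step.IH by linarith
  qed simp
  have dims: "dim_vec v = n" "dim_vec w = n"
    using v w by (auto simp: pos_vecs_def)
  have posv: "v $ i > 0" and posw: "w $ i > 0" if "i < n" for i
    using v w that by (auto simp: pos_vecs_def)
  show "\<exists>c>0. v = c \<cdot>\<^sub>v w"
  proof (cases "n = 0")
    case True
    then have "v = 1 \<cdot>\<^sub>v w"
      using dims by (intro eq_vecI) auto
    then show ?thesis
      by (intro exI[of _ 1]) auto
  next
    case False
    define c where "c = v $ 0 / w $ 0"
    have "v $ i = c * w $ i" if "i < n" for i
    proof -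
      have "v $ i / w $ i = c"
        unfolding c_def using False that by (intro antisym mono conn) auto
      then show ?thesis
        using posw[OF that] by (auto simp: field_simps)
    qed
    then have "v = c \<cdot>\<^sub>v w"
      using dims by (intro eq_vecI) auto
    moreover have "c > 0"
      using False posv posw by (simp add: c_def)
    ultimately show ?thesis
      by blast
  qed
qed

lemma eigenvector_row_sum:
  assumes A: "A \<in> carrier_mat n n" and ev: "eigenvector A w r" and i: "i < n"
  shows "(\<Sum>j<n. A $$ (i, j) * w $ j) = r * w $ i"
proof -
  have w: "w \<in> carrier_vec n" and eq: "A *\<^sub>v w = r \<cdot>\<^sub>v w"
    using ev A by (auto simp: eigenvector_def)
  have "(A *\<^sub>v w) $ i = (\<Sum>j<n. A $$ (i, j) * w $ j)"
    using A w i by (simp add: scalar_prod_def lessThan_atLeast0)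
  then show ?thesis
    using eq w i by simp
qed

text \<open>
  Dividing row \<open>i\<close> of the eigenvector equation by \<open>w\<^sub>i\<close> and adding up gives
  \<open>n r = \<Sum> a\<^sub>i\<^sub>j w\<^sub>j / w\<^sub>i\<close>, where the terms at \<open>(i, j)\<close> and \<open>(j, i)\<close> are inverse to each other and
  so have sum at least \<open>2\<close>.
\<close>
lemma reciprocal_eigenvalue_ge:
  assumes A: "A \<in> reciprocal_mats n" and w: "w \<in> pos_vecs n"
    and ev: "eigenvector A w r" and n: "n > 0"
  shows "real n \<le> r"
proof -
  have carrA: "A \<in> carrier_mat n n"
    using A by (simp add: reciprocal_mats_def)
  define z where "z i j = A $$ (i, j) * w $ j / w $ i" for i j
  have posw: "w $ i > 0" if "i < n" for i
    using w that by (simp add: pos_vecs_def)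
  have row: "(\<Sum>j<n. z i j) = r" if "i < n" for i
    using eigenvector_row_sum[OF carrA ev that] posw[OF that]
    by (simp add: z_def flip: sum_divide_distrib)
  have pair: "2 \<le> z i j + z j i" if "i < n" "j < n" for i j
  proof -
    have "A $$ (i, j) > 0" "A $$ (j, i) = 1 / A $$ (i, j)"
      using A that unfolding reciprocal_mats_def by blast+
    then have z: "z i j > 0" "z j i = 1 / z i j"
      using posw[OF that(1)] posw[OF that(2)] by (simp_all add: z_def)
    have "0 \<le> (z i j - 1)\<^sup>2"
      by simp
    then show ?thesis
      unfolding z(2) using z(1) by (simp add: field_simps power2_eq_square)
  qed
  have "2 * real n * real n = (\<Sum>i<n. \<Sum>j<n. 2)"
    by simp
  also have "\<dots> \<le> (\<Sum>i<n. \<Sum>j<n. z i j + z j i)"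
    by (intro sum_mono pair) auto
  also have "\<dots> = (\<Sum>i<n. \<Sum>j<n. z i j) + (\<Sum>i<n. \<Sum>j<n. z j i)"
    by (simp add: sum.distrib)
  also have "(\<Sum>i<n. \<Sum>j<n. z j i) = (\<Sum>i<n. \<Sum>j<n. z i j)"
    by (rule sum.swap)
  also have "(\<Sum>i<n. \<Sum>j<n. z i j) = real n * r"
    by (simp add: row)
  finally have "real n * real n \<le> real n * r"
    by (simp add: mult.commute)
  then show ?thesis
    using n by simp
qed

text \<open>
  The two equations say that \<open>x\<close>, extended by a last coordinate \<open>1\<close>, is an eigenvector of the
  all-ones matrix bordered by the column \<open>\<beta>\<close> and the row of its inverses. Put \<open>S = \<Sum> x\<^sub>j\<close>. If \<open>x < \<beta>\<close> everywhere, the last row gives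
  \<open>r - 1 < card I\<close>. If \<open>x > \<beta>\<close> everywhere, then \<open>S > (r - 1) \<beta>\<^sub>i\<close> for all \<open>i\<close>, and adding up with
  \<open>(r - card I) S = \<Sum> \<beta>\<^sub>i\<close> gives \<open>card I > (r - 1) (r - card I)\<close>; both contradict \<open>r \<ge> card I + 1\<close>.
\<close>
lemma bordered_crossing:
  fixes x \<beta> :: "'a \<Rightarrow> real" and r :: real
  assumes I: "finite I" "I \<noteq> {}"
    and pos: "\<And>i. i \<in> I \<Longrightarrow> x i > 0" "\<And>i. i \<in> I \<Longrightarrow> \<beta> i > 0"
    and row: "\<And>i. i \<in> I \<Longrightarrow> (\<Sum>j\<in>I. x j) + \<beta> i = r * x i"
    and last: "(\<Sum>j\<in>I. x j / \<beta> j) + 1 = r"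
    and r: "real (card I) + 1 \<le> r"
  shows "\<exists>i\<in>I. \<beta> i \<le> x i" and "\<exists>i\<in>I. x i \<le> \<beta> i"
proof -
  show "\<exists>i\<in>I. \<beta> i \<le> x i"
  proof (rule ccontr)
    assume "\<not> ?thesis"
    then have "(\<Sum>j\<in>I. x j / \<beta> j) < (\<Sum>j\<in>I. 1)"
      using I pos by (intro sum_strict_mono) (auto simp: not_le)
    then show False
      using last r by simp
  qed
  show "\<exists>i\<in>I. x i \<le> \<beta> i"
  proof (rule ccontr)
    assume neg: "\<not> ?thesis"
    define S where "S = (\<Sum>j\<in>I. x j)"
    have "S > 0"
      unfolding S_def using I pos by (intro sum_pos) auto
    have "(\<Sum>i\<in>I. S + \<beta> i) = (\<Sum>i\<in>I. r * x i)"
      using row by (intro sum.cong) (auto simp: S_def)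
    then have sum_\<beta>: "(\<Sum>i\<in>I. \<beta> i) = (r - card I) * S"
      by (simp add: sum.distrib S_def algebra_simps flip: sum_distrib_left)
    have "(r - 1) * \<beta> i < S" if "i \<in> I" for i
    proof -
      have "r * \<beta> i < r * x i"
        using neg that r by (intro mult_strict_left_mono) (auto simp: not_le)
      then show ?thesis
        using row[OF that] by (simp add: S_def algebra_simps)
    qed
    then have "(\<Sum>i\<in>I. (r - 1) * \<beta> i) < (\<Sum>i\<in>I. S)"
      using I by (intro sum_strict_mono) auto
    then have "(r - 1) * (r - card I) * S < card I * S"
      by (simp add: sum_\<beta> flip: sum_distrib_left)
    then have "(r - 1) * (r - card I) < card I"
      using \<open>S > 0\<close> by simp
    moreover have "real (card I) * 1 \<le> (r - 1) * (r - card I)"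
      using r by (intro mult_mono) auto
    ultimately show False
      by simp
  qed
qed

theorem theorem25:
  fixes n :: nat and A :: "real mat" and w :: "real vec"
  assumes "n \<ge> 2"
    and "A \<in> reciprocal_mats n"
    and "consistent_mat (n - 1) (mat_delete A (n - 1) (n - 1))"
    and "perron_vector n A w"
  shows "efficient n A w"
proof -
  define m where "m = n - 1"
  have n: "n = Suc m" and m: "m > 0"
    using assms(1) by (auto simp: m_def)
  have A: "A \<in> carrier_mat n n"
    and posA: "\<And>i j. i < n \<Longrightarrow> j < n \<Longrightarrow> A $$ (i, j) > 0"
    and recA: "\<And>i j. i < n \<Longrightarrow> j < n \<Longrightarrow> A $$ (j, i) = 1 / A $$ (i, j)"
    using assms(2) unfolding reciprocal_mats_def by blast+
  obtain r where w: "w \<in> pos_vecs n" and ev: "eigenvector A w r"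
    using assms(4) by (auto simp: perron_vector_def)
  have posw: "w $ i > 0" if "i < n" for i
    using w that by (simp add: pos_vecs_def)
  have del: "mat_delete A m m $$ (i, j) = A $$ (i, j)" if "i < m" "j < m" for i j
    using that A n by (auto simp: mat_delete_def)
  have cons: "A $$ (i, j) * A $$ (j, k) = A $$ (i, k)" if "i < m" "j < m" "k < m" for i j k
  proof -
    have "mat_delete A m m $$ (i, j) * mat_delete A m m $$ (j, k) = mat_delete A m m $$ (i, k)"
      using assms(3) that unfolding consistent_mat_def m_def[symmetric] by blast
    then show ?thesis
      using that by (simp add: del)
  qed

  \<comment> \<open>A consistent matrix has rank one, so its first column can serve as \<open>u\<close>.\<close>
  define u where "u i = A $$ (i, 0)" for i
  define x where "x i = w $ i / (u i * w $ m)" for i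
  define \<beta> where "\<beta> i = A $$ (i, m) / u i" for i
  have posu: "u i > 0" if "i < m" for i
    using posA that n by (simp add: u_def)
  have wm: "w $ m > 0"
    using posw n by simp
  have block: "A $$ (i, j) = u i / u j" if "i < m" "j < m" for i j
    using cons[of i j 0] that m posu[of j] by (simp add: u_def field_simps)
  have posx: "x i > 0" and pos\<beta>: "\<beta> i > 0" if "i < m" for i
    using that posu posw posA wm n by (auto simp: x_def \<beta>_def)

  have rowx: "(\<Sum>j<m. x j) + \<beta> i = r * x i" if i: "i < m" for i
  proof -
    have "(\<Sum>j<m. A $$ (i, j) * w $ j) + A $$ (i, m) * w $ m = r * w $ i"
      using eigenvector_row_sum[OF A ev, of i] i n by simp
    moreover have "(\<Sum>j<m. A $$ (i, j) * w $ j) = u i * w $ m * (\<Sum>j<m. x j)"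
      unfolding sum_distrib_left
    proof (rule sum.cong[OF refl])
      fix j assume "j \<in> {..<m}"
      then show "A $$ (i, j) * w $ j = u i * w $ m * x j"
        using block[of i j] i wm posu[of j] by (simp add: x_def field_simps)
    qed
    ultimately have "u i * w $ m * ((\<Sum>j<m. x j) + \<beta> i) = u i * w $ m * (r * x i)"
      using wm posu[OF i] by (simp add: x_def \<beta>_def field_simps)
    then show ?thesis
      using wm posu[OF i] by simp
  qed
  have last: "(\<Sum>j<m. x j / \<beta> j) + 1 = r"
  proof -
    have "(\<Sum>j<m. A $$ (m, j) * w $ j) + A $$ (m, m) * w $ m = r * w $ m"
      using eigenvector_row_sum[OF A ev, of m] n by simp
    moreover have "A $$ (m, m) = 1"
    proof -
      have "A $$ (m, m) > 0" "A $$ (m, m) = 1 / A $$ (m, m)"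
        using posA recA n by blast+
      then have "(A $$ (m, m))\<^sup>2 = 1"
        by (metis less_irrefl nonzero_eq_divide_eq power2_eq_square)
      then show ?thesis
        using \<open>A $$ (m, m) > 0\<close> by (auto simp: power2_eq_1_iff)
    qed
    moreover have "(\<Sum>j<m. A $$ (m, j) * w $ j) = w $ m * (\<Sum>j<m. x j / \<beta> j)"
      unfolding sum_distrib_left
    proof (rule sum.cong[OF refl])
      fix j assume "j \<in> {..<m}"
      then show "A $$ (m, j) * w $ j = w $ m * (x j / \<beta> j)"
        using recA[of j m] n wm posu[of j] posA[of j m] by (simp add: x_def \<beta>_def field_simps)
    qed
    ultimately have "w $ m * ((\<Sum>j<m. x j / \<beta> j) + 1) = w $ m * r"
      by (simp add: algebra_simps)
    then show ?thesis
      using wm by simp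
  qed
  have r: "real m + 1 \<le> r"
    using reciprocal_eigenvalue_ge[OF assms(2) w ev] n by simp

  have edge: "(i, j) \<in> outranking n A w" if "i < m" "j < m" "\<beta> j \<le> \<beta> i" for i j
  proof -
    have "r * x j \<le> r * x i"
      using rowx[OF that(1)] rowx[OF that(2)] that(3) by linarith
    then have "x j \<le> x i"
      using r by simp
    then have "u i / u j \<le> w $ i / w $ j"
      using that posu[of i] posu[of j] posw[of i] posw[of j] wm n
      by (simp add: x_def field_simps)
    then show ?thesis
      using that block n by (simp add: outranking_def)
  qed
  have to_m: "(i, m) \<in> outranking n A w" if "i < m" "\<beta> i \<le> x i" for i
    using that posu[of i] wm n by (simp add: outranking_def x_def \<beta>_def field_simps)
  have from_m: "(m, i) \<in> outranking n A w" if "i < m" "x i \<le> \<beta> i" for i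
  proof -
    have "1 / A $$ (i, m) \<le> w $ m / w $ i"
      using that posu[of i] wm n posw[of i] posA[of i m]
      by (simp add: x_def \<beta>_def field_simps)
    then show ?thesis
      using that recA[of i m] n by (simp add: outranking_def)
  qed

  have below_iff: "\<beta> i \<le> x i \<longleftrightarrow> (r - 1) * \<beta> i \<le> (\<Sum>j<m. x j)"
    and above_iff: "x i \<le> \<beta> i \<longleftrightarrow> (\<Sum>j<m. x j) \<le> (r - 1) * \<beta> i" if "i < m" for i
  proof -
    have "\<beta> i \<le> x i \<longleftrightarrow> r * \<beta> i \<le> r * x i" "x i \<le> \<beta> i \<longleftrightarrow> r * x i \<le> r * \<beta> i"
      using r by auto
    then show "\<beta> i \<le> x i \<longleftrightarrow> (r - 1) * \<beta> i \<le> (\<Sum>j<m. x j)"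
      and "x i \<le> \<beta> i \<longleftrightarrow> (\<Sum>j<m. x j) \<le> (r - 1) * \<beta> i"
      using rowx[OF that] by (auto simp: algebra_simps)
  qed
  obtain p where p: "p < m" "\<And>i. i < m \<Longrightarrow> \<beta> i \<le> \<beta> p"
    using Max_in[of "\<beta> ` {..<m}"] Max_ge[of "\<beta> ` {..<m}"] m by fastforce
  obtain q where q: "q < m" "\<And>i. i < m \<Longrightarrow> \<beta> q \<le> \<beta> i"
    using Min_in[of "\<beta> ` {..<m}"] Min_le[of "\<beta> ` {..<m}"] m by fastforce
  have ne: "{..<m} \<noteq> {}"
    using m by auto
  note crossing = bordered_crossing[of "{..<m}" x \<beta> r, simplified lessThan_iff card_lessThan,
      OF finite_lessThan ne posx pos\<beta> rowx last r]
  \<comment> \<open>By \<open>below_iff\<close> and \<open>above_iff\<close> a crossing anywhere in the block carries over to the extreme indices.\<close>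
  have "\<beta> q \<le> x q"
  proof -
    obtain i where i: "i < m" "\<beta> i \<le> x i"
      using crossing(1) by auto
    have "(r - 1) * \<beta> q \<le> (r - 1) * \<beta> i"
      using q(2)[OF i(1)] r by (intro mult_left_mono) auto
    then show ?thesis
      using i below_iff q(1) by fastforce
  qed
  have "x p \<le> \<beta> p"
  proof -
    obtain i where i: "i < m" "x i \<le> \<beta> i"
      using crossing(2) by auto
    have "(r - 1) * \<beta> i \<le> (r - 1) * \<beta> p"
      using p(2)[OF i(1)] r by (intro mult_left_mono) auto
    then show ?thesis
      using i above_iff p(1) by fastforce
  qed

  let ?R = "(outranking n A w)\<^sup>*"
  have qm: "(q, m) \<in> ?R" and mp: "(m, p) \<in> ?R"
    using to_m[OF q(1) \<open>\<beta> q \<le> x q\<close>] from_m[OF p(1) \<open>x p \<le> \<beta> p\<close>] by auto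
  \<comment> \<open>The vertex \<open>m\<close> is a hub: every \<open>i < m\<close> reaches it through \<open>q\<close> and is reached from it through \<open>p\<close>.\<close>
  have "(i, m) \<in> ?R \<and> (m, i) \<in> ?R" if "i < n" for i
  proof (cases "i = m")
    case False
    then have "i < m"
      using that n by simp
    then have "(i, q) \<in> ?R" "(p, i) \<in> ?R"
      using edge p q by auto
    then show ?thesis
      using qm mp by (meson rtrancl_trans)
  qed simp
  then show ?thesis
    by (intro efficient_if_strongly_connected[OF w]) (meson rtrancl_trans)
qed

end
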